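(* Let $I=I_1\times I_2\times\cdots\times I_n$, where each set $I_j$ is equal to $\mathbb{R}$, $(-\infty,a_j]$ or $[a_j,\infty)$ for some real number $a_j$ ($1\le j\le n$), and let $c_j\in\mathbb{C}$ with $|c_j|=1$ for all $j\in\mathbb{N}_n$. Suppose that $F:I\times X\to Y$ is continuous. Then the function $F(\cdot;\cdot)$ is semi-$(c_j,\mathcal{B})_{j\in\mathbb{N}_n}$-periodic if and only if for each set $B\in\mathcal{B}$ there exists a sequence of $(c_j)_{j\in\mathbb{N}_n}$-periodic functions $(F_k:I\to l_\infty(B:Y))_{k\in\mathbb{N}}$ such that $\lim_{k\to+\infty}F_k(\mathbf{t})=F_B(\mathbf{t})$ uniformly in $\mathbf{t}\in I$, where $[F_B(\mathbf{t})](x):=F(\mathbf{t};x)$ for $\mathbf{t}\in I$, $x\in B$.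
   Context: $X,Y$ are complex Banach spaces; $\mathbb{N}_n=\{1,\dots,n\}$; $(e_1,\dots,e_n)$ is the standard basis of $\mathbb{R}^n$. $\mathcal{B}$ is a collection of non-empty subsets of $X$ such that every $x\in X$ belongs to some $B\in\mathcal{B}$. $l_\infty(B:Y)$ is the Banach space of all bounded functions $f:B\to Y$, equipped with the sup-norm; the convergence of $F_k(\mathbf{t})$ to $F_B(\mathbf{t})$ is in this norm. A continuous function $F:I\times X\to Y$ is semi-$(c_j,\mathcal{B})_{j\in\mathbb{N}_n}$-periodic if for every $\epsilon>0$ and $B\in\mathcal{B}$ there exist real numbers $\omega_j\in\mathbb{R}\setminus\{0\}$ such that $\omega_je_j+I\subseteq I$ ($1\le j\le n$) and $\|F(\mathbf{t}+m\omega_je_j;x)-c_j^mF(\mathbf{t};x)\|_Y\le\epsilon$ for all $m\in\mathbb{N}$, $j\in\mathbb{N}_n$, $\mathbf{t}\in I$, $x\in B$. A continuous function $G:I\to Z$ ($Z$ a complex Banach space) is $(c_j)_{j\in\mathbb{N}_n}$-periodic if there exist $\omega_j\in\mathbb{R}\setminus\{0\}$ with $\omega_je_j+I\subseteq I$ ($1\le j\le n$) such that $G(\mathbf{t}+\omega_je_j)=c_jG(\mathbf{t})$ for all $\mathbf{t}\in I$ and $j\in\mathbb{N}_n$.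
   Formalization: The left side also requires each F_B to be continuous from I into l_∞(B:Y). Without it the claim fails: F(t;x)=sin(|x| sin t), B=X=ℂ, c=1, is semi-periodic but F_B is discontinuous. The right side implies this condition, so the converse is unchanged. *)

theory Defs
  imports "HOL-Analysis.Analysis"
begin

text \<open>The distribution only has real Banach spaces.  A complex Banach space is a real one
  together with a complex scalar multiplication that extends the real one and for which the norm
  is homogeneous.\<close>

class complex_banach = banach +
  fixes scaleC :: "complex \<Rightarrow> 'a \<Rightarrow> 'a"  (infixr \<open>*\<^sub>C\<close> 75)
  assumes scaleC_add_right: "a *\<^sub>C (x + y) = a *\<^sub>C x + a *\<^sub>C y"
    and scaleC_add_left: "(a + b) *\<^sub>C x = a *\<^sub>C x + b *\<^sub>C x"
    and scaleC_scaleC: "a *\<^sub>C b *\<^sub>C x = (a * b) *\<^sub>C x"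
    and scaleC_of_real: "complex_of_real r *\<^sub>C x = r *\<^sub>R x"
    and norm_scaleC: "norm (a *\<^sub>C x) = cmod a * norm x"

instantiation complex :: complex_banach
begin

definition scaleC_complex :: "complex \<Rightarrow> complex \<Rightarrow> complex"
  where "scaleC_complex a x = a * x"

instance
  by standard (simp_all add: scaleC_complex_def algebra_simps norm_mult scaleR_conv_of_real)

end

text \<open>A function of \<open>t\<close> and \<open>x\<close> is curried and total; only its values on \<open>I \<times> X\<close> matter.\<close>

definition semi_periodic ::
  "(real ^ 'n) set \<Rightarrow> ('n \<Rightarrow> complex) \<Rightarrow> 'a::complex_banach set set
    \<Rightarrow> (real ^ 'n \<Rightarrow> 'a \<Rightarrow> 'b::complex_banach) \<Rightarrow> bool" where
  "semi_periodic I c \<B> F \<longleftrightarrow>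
     continuous_on (I \<times> UNIV) (\<lambda>(t, x). F t x) \<and>
     (\<forall>\<epsilon>>0. \<forall>B\<in>\<B>. \<exists>\<omega> :: 'n \<Rightarrow> real.
        (\<forall>j. \<omega> j \<noteq> 0 \<and> (\<forall>t\<in>I. t + \<omega> j *\<^sub>R axis j 1 \<in> I)) \<and>
        (\<forall>m::nat. \<forall>j. \<forall>t\<in>I. \<forall>x\<in>B.
           norm (F (t + (real m * \<omega> j) *\<^sub>R axis j 1) x - (c j ^ m) *\<^sub>C F t x) \<le> \<epsilon>))"

text \<open>The target space \<open>Z\<close> is given by its norm metric and its scalar multiplication rather than
  by a type class, because it will be \<open>l\<^sub>\<infinity>(B : Y)\<close> with \<open>B\<close> a variable set.\<close>

definition cj_periodic ::
  "(real ^ 'n) set \<Rightarrow> ('n \<Rightarrow> complex) \<Rightarrow> 'z metric \<Rightarrow> (complex \<Rightarrow> 'z \<Rightarrow> 'z)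
    \<Rightarrow> (real ^ 'n \<Rightarrow> 'z) \<Rightarrow> bool" where
  "cj_periodic I c Z smul G \<longleftrightarrow>
     continuous_map (top_of_set I) (mtopology_of Z) G \<and>
     (\<exists>\<omega> :: 'n \<Rightarrow> real.
        (\<forall>j. \<omega> j \<noteq> 0 \<and> (\<forall>t\<in>I. t + \<omega> j *\<^sub>R axis j 1 \<in> I)) \<and>
        (\<forall>j. \<forall>t\<in>I. G (t + \<omega> j *\<^sub>R axis j 1) = smul (c j) (G t)))"

text \<open>\<open>l\<^sub>\<infinity>(B : Y)\<close>: its elements are the functions that are bounded on \<open>B\<close> and, so that they are
  determined by their values on \<open>B\<close>, \<open>undefined\<close> outside \<open>B\<close>.\<close>

definition l_inf :: "'a set \<Rightarrow> ('a \<Rightarrow> 'b::complex_banach) metric" where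
  "l_inf B = funspace B euclidean_metric"

definition l_inf_scale :: "'a set \<Rightarrow> complex \<Rightarrow> ('a \<Rightarrow> 'b::complex_banach) \<Rightarrow> 'a \<Rightarrow> 'b" where
  "l_inf_scale B a f = (\<lambda>x\<in>B. a *\<^sub>C f x)"

lemma mspace_l_inf: "mspace (l_inf B) = {f \<in> extensional B. bounded (f ` B)}"
  by (auto simp: l_inf_def Met_TC.fspace_def)

lemma mdist_l_inf:
  assumes "f \<in> mspace (l_inf B)" "g \<in> mspace (l_inf B)" "B \<noteq> {}"
  shows "mdist (l_inf B) f g = (SUP x\<in>B. norm (f x - g x))"
  using assms by (simp add: l_inf_def Met_TC.fdist_def dist_norm)

definition F_on :: "(real ^ 'n \<Rightarrow> 'a \<Rightarrow> 'b) \<Rightarrow> 'a set \<Rightarrow> real ^ 'n \<Rightarrow> 'a \<Rightarrow> 'b" where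
  "F_on F B t = (\<lambda>x\<in>B. F t x)"

text \<open>Uniform convergence on \<open>I\<close> in the metric of \<open>Z\<close>.  Membership of the limit in \<open>Z\<close> has to be
  required, because \<open>mdist\<close> has no meaning outside \<open>mspace\<close>.\<close>

definition converges_uniformly ::
  "'t set \<Rightarrow> 'z metric \<Rightarrow> (nat \<Rightarrow> 't \<Rightarrow> 'z) \<Rightarrow> ('t \<Rightarrow> 'z) \<Rightarrow> bool" where
  "converges_uniformly I Z G g \<longleftrightarrow>
     (\<forall>t\<in>I. g t \<in> mspace Z) \<and>
     (\<forall>\<epsilon>>0. \<forall>\<^sub>F k in sequentially. \<forall>t\<in>I. mdist Z (G k t) (g t) < \<epsilon>)"

end

theory Submission
  imports Defs
begin

text \<open>
  For the direct implication, a semi-periodic function is made exactly periodic one coordinate at a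
  time.  If \<open>G\<close> is almost \<open>(\<omega>, c)\<close>-periodic in a coordinate \<open>s\<close> (measured in units of \<open>\<omega>\<close>) and \<open>\<psi>\<close> is the
  hat function on \<open>[0, 2]\<close> whose integer translates sum up to \<open>1\<close>, then
  \<open>\<Sum>\<^sub>k \<psi>(s - k) c\<^sup>k G(s - k)\<close> is continuous, exactly periodic and as close to \<open>G\<close> as the defect of \<open>G\<close>
  permits.  Being an average of unimodular multiples of translates in that coordinate, it inherits
  from \<open>G\<close> all exact and approximate periods in the other coordinates.
\<close>

section \<open>Complex scalars and convex combinations with unimodular factors\<close>

lemma bounded_linear_scaleC: "bounded_linear ((*\<^sub>C) a :: 'b::complex_banach \<Rightarrow> 'b)"
proof (rule bounded_linear_intro)
  show "a *\<^sub>C r *\<^sub>R x = r *\<^sub>R a *\<^sub>C x" for r and x :: 'b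
    by (simp add: scaleC_scaleC mult.commute flip: scaleC_of_real)
  show "norm (a *\<^sub>C x) \<le> norm x * cmod a" for x :: 'b
    by (simp add: norm_scaleC mult.commute)
qed (rule scaleC_add_right)

lemma scaleC_diff_right: "a *\<^sub>C (x - y) = a *\<^sub>C x - a *\<^sub>C (y::'b::complex_banach)"
  by (rule linear_diff[OF bounded_linear.linear[OF bounded_linear_scaleC]])

lemma scaleC_one [simp]: "1 *\<^sub>C (x::'b::complex_banach) = x"
  using scaleC_of_real[of 1 x] by simp

lemma scaleC_scaleR_commute: "a *\<^sub>C r *\<^sub>R x = r *\<^sub>R a *\<^sub>C (x::'b::complex_banach)"
  by (rule linear_scale[OF bounded_linear.linear[OF bounded_linear_scaleC]])

text \<open>Unimodular factors preserve norms and the weights sum to 1, so no constant is lost; both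
  error estimates for \<open>fold_coord\<close> reduce to this bound.\<close>

lemma norm_unimodular_mix_le:
  fixes p q :: "'b::complex_banach"
  assumes r: "0 \<le> r" "r \<le> 1" and uv: "cmod u = 1" "cmod v = 1"
    and pq: "norm p \<le> \<delta>" "norm q \<le> \<delta>"
  shows "norm (r *\<^sub>R u *\<^sub>C p + (1 - r) *\<^sub>R v *\<^sub>C q) \<le> \<delta>"
proof -
  have "norm (r *\<^sub>R u *\<^sub>C p + (1 - r) *\<^sub>R v *\<^sub>C q) \<le> r * norm p + (1 - r) * norm q"
    using norm_triangle_ineq[of "r *\<^sub>R u *\<^sub>C p" "(1 - r) *\<^sub>R v *\<^sub>C q"] r uv
    by (simp add: norm_scaleC)
  also have "\<dots> \<le> r * \<delta> + (1 - r) * \<delta>"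
    using r pq by (intro add_mono mult_left_mono) auto
  finally show ?thesis by (simp add: algebra_simps)
qed

section \<open>Metric and continuity in the space of bounded functions\<close>

lemma mdist_l_inf_le:
  assumes "f \<in> mspace (l_inf B)" "g \<in> mspace (l_inf B)" "B \<noteq> {}"
    and "\<And>x. x \<in> B \<Longrightarrow> norm (f x - g x) \<le> \<epsilon>"
  shows "mdist (l_inf B) f g \<le> \<epsilon>"
  unfolding mdist_l_inf[OF assms(1-3)] using assms by (intro cSUP_least) auto

lemma norm_diff_le_mdist_l_inf:
  fixes f g :: "'a \<Rightarrow> 'b::complex_banach"
  assumes fg: "f \<in> mspace (l_inf B)" "g \<in> mspace (l_inf B)" and x: "x \<in> B"
  shows "norm (f x - g x) \<le> mdist (l_inf B) f g"
proof -
  have "bounded (f ` B)" "bounded (g ` B)"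
    using fg by (auto simp: mspace_l_inf)
  then have "bounded ((\<lambda>x. f x - g x) ` B)"
    by (rule bounded_minus_comp)
  then have "bdd_above ((\<lambda>x. norm (f x - g x)) ` B)"
    by (auto simp: bounded_iff bdd_above_def)
  then show ?thesis
    using x mdist_l_inf[OF fg] by (metis (no_types, lifting) cSUP_upper empty_iff)
qed

text \<open>Convergence in the sup-norm is uniform convergence on \<open>B\<close>. Phrasing
  continuity by \<open>uniform_limit\<close> gives access to sums and products, whereas
  \<open>l_inf B\<close> is only a metric.\<close>

lemma continuous_map_l_inf:
  fixes G :: "'t \<Rightarrow> 'a \<Rightarrow> 'b::complex_banach"
  assumes B: "B \<noteq> {}"
  shows "continuous_map X (mtopology_of (l_inf B)) G \<longleftrightarrow>
    (\<forall>t\<in>topspace X. G t \<in> mspace (l_inf B) \<and> uniform_limit B G (G t) (atin X t))"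
proof -
  let ?L = "l_inf B :: ('a \<Rightarrow> 'b) metric"
  interpret L: Metric_space "mspace ?L" "mdist ?L" by simp
  have lim: "limitin (mtopology_of ?L) G (G t) (atin X t) \<longleftrightarrow> uniform_limit B G (G t) (atin X t)"
    if sp: "\<And>s. s \<in> topspace X \<Longrightarrow> G s \<in> mspace ?L" and t: "t \<in> topspace X" for t
  proof -
    \<comment> \<open>\<open>limitin\<close> in a metric also demands that values eventually lie in
      \<open>mspace\<close>; \<open>topspace X\<close> is itself an open neighbourhood of
      \<open>t\<close>.\<close>
    have ev: "\<forall>\<^sub>F s in atin X t. G s \<in> mspace ?L"
      using sp t unfolding eventually_atin by (metis openin_topspace DiffD1)
    have "limitin (mtopology_of ?L) G (G t) (atin X t) \<longleftrightarrow>
        (\<forall>\<epsilon>>0. \<forall>\<^sub>F s in atin X t. mdist ?L (G s) (G t) < \<epsilon>)"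
      using sp[OF t] ev by (auto simp: mtopology_of_def L.limitin_metric eventually_conj_iff)
    also have "\<dots> \<longleftrightarrow> uniform_limit B G (G t) (atin X t)"
    proof
      assume *: "\<forall>\<epsilon>>0. \<forall>\<^sub>F s in atin X t. mdist ?L (G s) (G t) < \<epsilon>"
      show "uniform_limit B G (G t) (atin X t)"
      proof (rule uniform_limitI)
        fix \<epsilon> :: real assume "\<epsilon> > 0"
        with * have "\<forall>\<^sub>F s in atin X t. mdist ?L (G s) (G t) < \<epsilon>" by blast
        with ev show "\<forall>\<^sub>F s in atin X t. \<forall>x\<in>B. dist (G s x) (G t x) < \<epsilon>"
        proof eventually_elim
          case (elim s)
          then show ?case
            using norm_diff_le_mdist_l_inf[OF elim(1) sp[OF t]] by (fastforce simp: dist_norm)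
        qed
      qed
    next
      assume *: "uniform_limit B G (G t) (atin X t)"
      show "\<forall>\<epsilon>>0. \<forall>\<^sub>F s in atin X t. mdist ?L (G s) (G t) < \<epsilon>"
      proof (intro allI impI)
        fix \<epsilon> :: real assume \<epsilon>: "\<epsilon> > 0"
        \<comment> \<open>A supremum of values below a bound may equal that bound; halving
          \<epsilon> keeps the final inequality strict.\<close>
        then have "\<forall>\<^sub>F s in atin X t. \<forall>x\<in>B. dist (G s x) (G t x) < \<epsilon> / 2"
          using uniform_limitD[OF *, of "\<epsilon> / 2"] by linarith
        with ev show "\<forall>\<^sub>F s in atin X t. mdist ?L (G s) (G t) < \<epsilon>"
        proof eventually_elim
          case (elim s)
          then have "mdist ?L (G s) (G t) \<le> \<epsilon> / 2"
            using sp[OF t] B by (intro mdist_l_inf_le) (auto simp: dist_norm less_imp_le)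
          with \<epsilon> show ?case by simp
        qed
      qed
    qed
    finally show ?thesis .
  qed
  have "G t \<in> mspace ?L" if "continuous_map X (mtopology_of ?L) G" "t \<in> topspace X" for t
    using that continuous_map_image_subset_topspace by fastforce
  then show ?thesis
    using lim by (auto simp: continuous_map_atin)
qed

lemma continuous_map_l_inf_mix:
  fixes G H :: "'t \<Rightarrow> 'a \<Rightarrow> 'b::complex_banach"
  assumes B: "B \<noteq> {}"
    and G: "continuous_map X (mtopology_of (l_inf B)) G"
    and H: "continuous_map X (mtopology_of (l_inf B)) H"
    and r: "continuous_map X euclideanreal r"
  shows "continuous_map X (mtopology_of (l_inf B))
    (\<lambda>t. \<lambda>x\<in>B. r t *\<^sub>R u *\<^sub>C G t x + (1 - r t) *\<^sub>R v *\<^sub>C H t x)"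
  unfolding continuous_map_l_inf[OF B]
proof (intro ballI conjI)
  fix t assume t: "t \<in> topspace X"
  have summand: "uniform_limit B (\<lambda>s x. q s *\<^sub>R w *\<^sub>C K s x) (\<lambda>x. q t *\<^sub>R w *\<^sub>C K t x) (atin X t)"
      "bounded ((\<lambda>x. q t *\<^sub>R w *\<^sub>C K t x) ` B)"
    if K: "continuous_map X (mtopology_of (l_inf B)) K"
      and q: "continuous_map X euclideanreal q" for K :: "'t \<Rightarrow> 'a \<Rightarrow> 'b" and q w
  proof -
    have Kt: "uniform_limit B K (K t) (atin X t)" "bounded (K t ` B)"
      using K t by (auto simp: continuous_map_l_inf[OF B] mspace_l_inf)
    have Kw: "uniform_limit B (\<lambda>s x. w *\<^sub>C K s x) (\<lambda>x. w *\<^sub>C K t x) (atin X t)"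
      by (rule bounded_linear.uniform_limit[OF bounded_linear_scaleC Kt(1)])
    have Kwb: "bounded ((\<lambda>x. w *\<^sub>C K t x) ` B)"
      using bounded_linear_image[OF Kt(2) bounded_linear_scaleC] by (simp add: image_image)
    have "(q \<longlongrightarrow> q t) (atin X t)"
      using q t by (simp add: continuous_map_atin)
    \<comment> \<open>A scalar limit, read as constant in \<open>x\<close>, is uniform on
      \<open>B\<close>; the product rule then needs both limits to be bounded on
      \<open>B\<close>.\<close>
    then have "uniform_limit B (\<lambda>s x. q s) (\<lambda>x. q t) (atin X t)"
      by (auto simp: uniform_limit_iff tendsto_iff)
    then show "uniform_limit B (\<lambda>s x. q s *\<^sub>R w *\<^sub>C K s x) (\<lambda>x. q t *\<^sub>R w *\<^sub>C K t x) (atin X t)"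
      using Kw Kwb by (intro uniform_limit_intros) (auto simp: image_constant_conv)
    show "bounded ((\<lambda>x. q t *\<^sub>R w *\<^sub>C K t x) ` B)"
      using bounded_scaling[OF Kwb, of "q t"] by (simp add: image_image)
  qed
  have r': "continuous_map X euclideanreal (\<lambda>s. 1 - r s)"
    by (intro continuous_intros r)
  note rG = summand[OF G r, of u] and rH = summand[OF H r', of v]
  show "(\<lambda>x\<in>B. r t *\<^sub>R u *\<^sub>C G t x + (1 - r t) *\<^sub>R v *\<^sub>C H t x) \<in> mspace (l_inf B)"
    using bounded_plus_comp[OF rG(2) rH(2)] by (simp add: mspace_l_inf)
  show "uniform_limit B (\<lambda>s. \<lambda>x\<in>B. r s *\<^sub>R u *\<^sub>C G s x + (1 - r s) *\<^sub>R v *\<^sub>C H s x)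
      (\<lambda>x\<in>B. r t *\<^sub>R u *\<^sub>C G t x + (1 - r t) *\<^sub>R v *\<^sub>C H t x) (atin X t)"
    using uniform_limit_add[OF rG(1) rH(1)] by (rule uniform_limit_cong'[THEN iffD1, rotated 2]) auto
qed

section \<open>Folding a function to exact periodicity in one coordinate\<close>

text \<open>On the strip \<open>k \<le> (t $ j - b) / \<omega> \<le> k + 1\<close> only two summands of the hat function series are
  nonzero.  They evaluate \<open>G\<close> within the first two periods counted from the base point \<open>b\<close>, so
  the translates never leave a half-line.\<close>

definition fold_mix ::
  "'n::finite \<Rightarrow> real \<Rightarrow> real \<Rightarrow> complex \<Rightarrow> 'a set \<Rightarrow> (real ^ 'n \<Rightarrow> 'a \<Rightarrow> 'b::complex_banach)
    \<Rightarrow> int \<Rightarrow> real ^ 'n \<Rightarrow> 'a \<Rightarrow> 'b" where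
  "fold_mix j b \<omega> a B G k t = (\<lambda>x\<in>B.
     ((t $ j - b) / \<omega> - k) *\<^sub>R (a powi k) *\<^sub>C G (t - (k * \<omega>) *\<^sub>R axis j 1) x +
     (1 - ((t $ j - b) / \<omega> - k)) *\<^sub>R (a powi (k - 1)) *\<^sub>C G (t - (real_of_int (k - 1) * \<omega>) *\<^sub>R axis j 1) x)"

text \<open>With \<open>s = (t $ j - b) / \<omega>\<close> and \<open>k\<close> its floor, the hat
  function takes the value \<open>s - k\<close> at \<open>s - k\<close> and
  \<open>1 - (s - k)\<close> at \<open>s - (k - 1)\<close>, which are the weights of
  \<open>fold_mix\<close>; so this is the whole hat function series.\<close>

definition fold_coord ::
  "'n::finite \<Rightarrow> real \<Rightarrow> real \<Rightarrow> complex \<Rightarrow> 'a set \<Rightarrow> (real ^ 'n \<Rightarrow> 'a \<Rightarrow> 'b::complex_banach)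
    \<Rightarrow> real ^ 'n \<Rightarrow> 'a \<Rightarrow> 'b" where
  "fold_coord j b \<omega> a B G t = fold_mix j b \<omega> a B G \<lfloor>(t $ j - b) / \<omega>\<rfloor> t"

text \<open>The floor jumps, but neighbouring mixes agree where their strips meet: at
  \<open>?s t = k + 1\<close> the weights of mix \<open>k\<close> are 1 and 0, those of mix
  \<open>k + 1\<close> are 0 and 1, and both keep only the translate by \<open>k\<close> periods.
  The closed strips form a locally finite cover, so the mixes can be pasted.\<close>

lemma continuous_map_fold_coord:
  fixes G :: "real ^ 'n::finite \<Rightarrow> 'a \<Rightarrow> 'b::complex_banach"
  assumes B: "B \<noteq> {}"
    and G: "continuous_map (top_of_set I) (mtopology_of (l_inf B)) G"
    and \<omega>: "\<omega> \<noteq> 0"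
    and base: "\<And>t k. t \<in> I \<Longrightarrow> real_of_int k \<le> (t $ j - b) / \<omega> \<Longrightarrow> t - (k * \<omega>) *\<^sub>R axis j 1 \<in> I"
  shows "continuous_map (top_of_set I) (mtopology_of (l_inf B)) (fold_coord j b \<omega> a B G)"
proof -
  let ?s = "\<lambda>t::real^'n. (t $ j - b) / \<omega>"
  let ?T = "\<lambda>k::int. {t. of_int k \<le> ?s t \<and> ?s t \<le> of_int k + 1}"
  have cont_s: "continuous_on S ?s" for S
    using \<omega> by (intro continuous_intros) auto
  show ?thesis
  proof (rule pasting_lemma_locally_finite[where I = UNIV and T = "\<lambda>k. I \<inter> ?T k"
        and f = "fold_mix j b \<omega> a B G"])
    fix k :: int
    have "closed (?T k)"
      unfolding Collect_conj_eq
      by (intro closed_Int closed_Collect_le continuous_on_const cont_s)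
    then show "closedin (top_of_set I) (I \<inter> ?T k)"
      by (rule closedin_closed_Int)
    \<comment> \<open>Strip \<open>k\<close> lies in the region \<open>k \<le> ?s t\<close>, so
      \<open>base\<close> covers every \<open>l \<le> k\<close>, in particular the two shifts
      \<open>k\<close> and \<open>k - 1\<close> of the mix.\<close>
    have shift: "continuous_map (top_of_set (I \<inter> ?T k)) (mtopology_of (l_inf B))
        (\<lambda>t. G (t - (l * \<omega>) *\<^sub>R axis j 1))" if "l \<le> k" for l :: int
    proof -
      have "continuous_map (top_of_set (I \<inter> ?T k)) (top_of_set I) (\<lambda>t. t - (l * \<omega>) *\<^sub>R axis j 1)"
        using that by (auto intro!: continuous_intros base)
      from continuous_map_compose[OF this G] show ?thesis
        by (simp add: o_def)
    qed
    show "continuous_map (subtopology (top_of_set I) (I \<inter> ?T k)) (mtopology_of (l_inf B))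
        (fold_mix j b \<omega> a B G k)"
      unfolding fold_mix_def subtopology_subtopology Int_absorb Int_assoc[symmetric]
      by (intro continuous_map_l_inf_mix[OF B] shift)
        (auto intro!: continuous_intros cont_s)
  next
    fix k l :: int and t
    assume t: "t \<in> topspace (top_of_set I) \<inter> (I \<inter> ?T k) \<inter> (I \<inter> ?T l)"
    have eq: "fold_mix j b \<omega> a B G (k + 1) t = fold_mix j b \<omega> a B G k t"
      if "?s t = of_int k + 1" for k
      unfolding fold_mix_def that by (simp add: that)
    consider "k = l" | "l = k + 1" | "k = l + 1" 
      using t by auto linarith
    then show "fold_mix j b \<omega> a B G k t = fold_mix j b \<omega> a B G l t"
    proof cases
      case 2
      then have "?s t = of_int k + 1" using t by auto
      from eq[OF this] 2 show ?thesis by simp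
    next
      case 3
      then have "?s t = of_int l + 1" using t by auto
      from eq[OF this] 3 show ?thesis by simp
    qed simp
  next
    fix t assume "t \<in> topspace (top_of_set I)"
    then have t: "t \<in> I" by simp
    show "\<exists>k. k \<in> UNIV \<and> t \<in> I \<inter> ?T k \<and> fold_coord j b \<omega> a B G t = fold_mix j b \<omega> a B G k t"
      using t by (intro exI[of _ "\<lfloor>?s t\<rfloor>"]) (auto simp: fold_coord_def; linarith)
    \<comment> \<open>Local finiteness: \<open>?s\<close> varies by less than 1 on
      \<open>?V\<close>, so only strips near the floor of \<open>?s t\<close> meet it; the margin 3
      is generous.\<close>
    let ?V = "{u. ?s t - 1 < ?s u \<and> ?s u < ?s t + 1}"
    have "open ?V"
      unfolding Collect_conj_eq
      by (intro open_Int open_Collect_less continuous_on_const cont_s)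
    moreover have "{k \<in> UNIV. (I \<inter> ?T k) \<inter> (I \<inter> ?V) \<noteq> {}} \<subseteq> {\<lfloor>?s t\<rfloor> - 3..\<lfloor>?s t\<rfloor> + 3}"
    proof
      fix k assume "k \<in> {k \<in> UNIV. (I \<inter> ?T k) \<inter> (I \<inter> ?V) \<noteq> {}}"
      then obtain u where "of_int k \<le> ?s u" "?s u \<le> of_int k + 1" "?s t - 1 < ?s u" "?s u < ?s t + 1"
        by auto
      then show "k \<in> {\<lfloor>?s t\<rfloor> - 3..\<lfloor>?s t\<rfloor> + 3}"
        unfolding atLeastAtMost_iff by linarith
    qed
    ultimately show "\<exists>V. openin (top_of_set I) V \<and> t \<in> V \<and> finite {k \<in> UNIV. (I \<inter> ?T k) \<inter> V \<noteq> {}}"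
      using t finite_subset[OF _ finite_atLeastAtMost_int]
      by (intro exI[of _ "I \<inter> ?V"]) (auto intro!: openin_open_Int)
  qed
qed

text \<open>The step by \<omega> raises both the normalised coordinate and its floor by 1. Weights
  and evaluation points stay the same, and each power of \<open>a\<close> gains one factor.\<close>

lemma fold_coord_periodic:
  assumes \<omega>: "\<omega> \<noteq> 0" and a: "cmod a = 1" and x: "x \<in> B"
  shows "fold_coord j b \<omega> a B G (t + \<omega> *\<^sub>R axis j 1) x = a *\<^sub>C fold_coord j b \<omega> a B G t x"
proof -
  define s where "s = (t $ j - b) / \<omega>"
  define k where "k = \<lfloor>s\<rfloor>"
  have s: "((t + \<omega> *\<^sub>R axis j 1) $ j - b) / \<omega> = s + 1"
    using \<omega> by (simp add: s_def field_simps)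
  have k: "\<lfloor>s + 1\<rfloor> = k + 1"
    by (simp add: k_def)
  have unshift:
    "t + \<omega> *\<^sub>R axis j 1 - (real_of_int (k + 1) * \<omega>) *\<^sub>R axis j 1 = t - (real_of_int k * \<omega>) *\<^sub>R axis j 1"
    "t + \<omega> *\<^sub>R axis j 1 - (real_of_int k * \<omega>) *\<^sub>R axis j 1 = t - (real_of_int (k - 1) * \<omega>) *\<^sub>R axis j 1"
    by (simp_all add: algebra_simps)
  have "a \<noteq> 0" using a by auto
  then have "a powi (k + 1) = a * a powi k" "a powi k = a * a powi (k - 1)"
    using power_int_add_1'[of a k] power_int_add_1'[of a "k - 1"] by auto
  then show ?thesis
    using x unfolding fold_coord_def fold_mix_def s s_def[symmetric] k k_def[symmetric]
      add_diff_cancel_right' unshift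
    by (simp add: scaleC_add_right scaleC_scaleR_commute scaleC_scaleC)
qed

text \<open>As the weights sum to 1, \<open>G t x\<close> is the same mix of the terms
  \<open>a powi l *\<^sub>C a powi (- l) *\<^sub>C G t x\<close>. The error is therefore a mix of
  the defects of \<open>G\<close> under translation.\<close>

lemma fold_coord_approx:
  fixes G :: "real ^ 'n::finite \<Rightarrow> 'a \<Rightarrow> 'b::complex_banach"
  assumes a: "cmod a = 1" and x: "x \<in> B" and t: "t \<in> I"
    and base: "\<And>k. real_of_int k \<le> (t $ j - b) / \<omega> \<Longrightarrow> t - (k * \<omega>) *\<^sub>R axis j 1 \<in> I"
    and approx: "\<And>(m::nat) t. t \<in> I \<Longrightarrow> norm (G (t + (real m * \<omega>) *\<^sub>R axis j 1) x - (a ^ m) *\<^sub>C G t x) \<le> \<epsilon>"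
  shows "norm (fold_coord j b \<omega> a B G t x - G t x) \<le> \<epsilon>"
proof -
  define s where "s = (t $ j - b) / \<omega>"
  define k where "k = \<lfloor>s\<rfloor>"
  have "a \<noteq> 0" using a by auto
  have unit: "cmod (a powi l) = 1" for l
    using a by (simp add: norm_power_int)
  have cancel: "a powi l *\<^sub>C a powi (- l) *\<^sub>C G t x = G t x" for l
    using \<open>a \<noteq> 0\<close> by (simp add: scaleC_scaleC flip: power_int_add)
  \<comment> \<open>For \<open>l \<le> 0\<close> the translate lies ahead of \<open>t\<close> and
    \<open>approx\<close> applies at \<open>t\<close>. For \<open>l > 0\<close> it lies behind:
    \<open>approx\<close> applies at the translate, and the unimodular factor is moved
    across.\<close>
  have D: "norm (G (t - (l * \<omega>) *\<^sub>R axis j 1) x - a powi (- l) *\<^sub>C G t x) \<le> \<epsilon>" if l: "l \<le> k" for l :: int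
  proof (cases "l \<le> 0")
    case True
    then show ?thesis
      using approx[OF t, of "nat (- l)"] by (simp add: power_int_def)
  next
    case False
    let ?t = "t - (l * \<omega>) *\<^sub>R axis j 1"
    have "?t \<in> I"
      using l by (intro base) (simp add: k_def s_def le_floor_iff)
    from approx[OF this, of "nat l"] False
    have "norm (G t x - a powi l *\<^sub>C G ?t x) \<le> \<epsilon>"
      by (simp add: power_int_def)
    moreover have "G t x - a powi l *\<^sub>C G ?t x = a powi l *\<^sub>C (a powi (- l) *\<^sub>C G t x - G ?t x)"
      by (simp add: scaleC_diff_right cancel)
    ultimately show ?thesis
      by (simp add: norm_scaleC unit norm_minus_commute)
  qed
  let ?p = "\<lambda>l::int. G (t - (l * \<omega>) *\<^sub>R axis j 1) x - a powi (- l) *\<^sub>C G t x"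
  have "fold_coord j b \<omega> a B G t x - G t x =
      (s - k) *\<^sub>R a powi k *\<^sub>C ?p k + (1 - (s - k)) *\<^sub>R a powi (k - 1) *\<^sub>C ?p (k - 1)"
    using x cancel[of k] cancel[of "k - 1"]
    by (simp add: fold_coord_def fold_mix_def s_def[symmetric] k_def[symmetric]
      scaleC_diff_right algebra_simps)
  also have "norm \<dots> \<le> \<epsilon>"
  proof (rule norm_unimodular_mix_le)
    show "0 \<le> s - k" "s - k \<le> 1"
      unfolding k_def by linarith+
  qed (use unit D[of k] D[of "k - 1"] in auto)
  finally show ?thesis .
qed

text \<open>A shift orthogonal to the folded axis changes neither the weights nor the floor, and
  folding is linear in \<open>G\<close>, so the defect of the result is a mix of defects of
  \<open>G\<close>.\<close>

lemma fold_coord_shift: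
  fixes G :: "real ^ 'n::finite \<Rightarrow> 'a \<Rightarrow> 'b::complex_banach"
  assumes a: "cmod a = 1" and x: "x \<in> B" and v: "v $ j = 0"
    and base: "\<And>k. real_of_int k \<le> (t $ j - b) / \<omega> \<Longrightarrow> t - (k * \<omega>) *\<^sub>R axis j 1 \<in> I"
    and approx: "\<And>t. t \<in> I \<Longrightarrow> norm (G (t + v) x - d *\<^sub>C G t x) \<le> \<delta>"
  shows "norm (fold_coord j b \<omega> a B G (t + v) x - d *\<^sub>C fold_coord j b \<omega> a B G t x) \<le> \<delta>"
proof -
  define s where "s = (t $ j - b) / \<omega>"
  define k where "k = \<lfloor>s\<rfloor>"
  have sv: "((t + v) $ j - b) / \<omega> = s"
    using v by (simp add: s_def)
  have unit: "cmod (a powi l) = 1" for l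
    using a by (simp add: norm_power_int)
  let ?t = "\<lambda>l::int. t - (l * \<omega>) *\<^sub>R axis j 1"
  let ?p = "\<lambda>l::int. G (?t l + v) x - d *\<^sub>C G (?t l) x"
  have D: "norm (?p l) \<le> \<delta>" if "l \<le> k" for l :: int
    using that by (intro approx base) (simp add: k_def s_def le_floor_iff)
  have tv: "t + v - (l * \<omega>) *\<^sub>R axis j 1 = ?t l + v" for l :: int
    by simp
  have swap: "d *\<^sub>C a powi l *\<^sub>C y = a powi l *\<^sub>C d *\<^sub>C y" for l and y :: 'b
    by (simp add: scaleC_scaleC mult.commute)
  have mix: "fold_coord j b \<omega> a B G (t + v) x - d *\<^sub>C fold_coord j b \<omega> a B G t x =
      (s - k) *\<^sub>R a powi k *\<^sub>C ?p k + (1 - (s - k)) *\<^sub>R a powi (k - 1) *\<^sub>C ?p (k - 1)"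
    using x unfolding fold_coord_def fold_mix_def sv s_def[symmetric] k_def[symmetric] tv
    by (simp add: scaleC_diff_right scaleC_add_right scaleC_scaleR_commute swap scaleR_diff_right)
  show ?thesis
    unfolding mix
  proof (rule norm_unimodular_mix_le)
    show "0 \<le> s - k" "s - k \<le> 1"
      unfolding k_def by linarith+
  qed (use unit D[of k] D[of "k - 1"] in auto)
qed

section \<open>Folding all coordinates in turn\<close>

text \<open>Induction on the set \<open>A\<close> of coordinates already folded. The last conjunct
  carries it: the approximate periods in the remaining coordinates survive with the same \<epsilon>,
  so each new coordinate adds just one \<epsilon> to the error.\<close>

lemma exists_periodic_approx:
  fixes G :: "real ^ 'n::finite \<Rightarrow> 'a \<Rightarrow> 'b::complex_banach"
  assumes B: "B \<noteq> {}"
    and G: "continuous_map (top_of_set I) (mtopology_of (l_inf B)) G"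
    and c: "\<And>j. cmod (c j) = 1" and \<omega>: "\<And>j. \<omega> j \<noteq> 0"
    and base: "\<And>j t k. t \<in> I \<Longrightarrow> real_of_int k \<le> (t $ j - b j) / \<omega> j
        \<Longrightarrow> t - (k * \<omega> j) *\<^sub>R axis j 1 \<in> I"
    and approx: "\<And>(m::nat) j t x. t \<in> I \<Longrightarrow> x \<in> B
        \<Longrightarrow> norm (G (t + (real m * \<omega> j) *\<^sub>R axis j 1) x - (c j ^ m) *\<^sub>C G t x) \<le> \<epsilon>"
    and A: "finite A"
  shows "\<exists>H. continuous_map (top_of_set I) (mtopology_of (l_inf B)) H \<and>
      (\<forall>j\<in>A. \<forall>t\<in>I. \<forall>x\<in>B. H (t + \<omega> j *\<^sub>R axis j 1) x = c j *\<^sub>C H t x) \<and>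
      (\<forall>t\<in>I. \<forall>x\<in>B. norm (H t x - G t x) \<le> real (card A) * \<epsilon>) \<and>
      (\<forall>v d \<delta>. (\<forall>j\<in>A. v $ j = 0) \<longrightarrow>
         (\<forall>t\<in>I. \<forall>x\<in>B. norm (G (t + v) x - d *\<^sub>C G t x) \<le> \<delta>) \<longrightarrow>
         (\<forall>t\<in>I. \<forall>x\<in>B. norm (H (t + v) x - d *\<^sub>C H t x) \<le> \<delta>))"
  using A
proof induction
  case empty
  show ?case using G by (intro exI[of _ G]) auto
next
  case (insert i A)
  then obtain H where H: "continuous_map (top_of_set I) (mtopology_of (l_inf B)) H"
    and per: "\<And>j t x. j \<in> A \<Longrightarrow> t \<in> I \<Longrightarrow> x \<in> B \<Longrightarrow> H (t + \<omega> j *\<^sub>R axis j 1) x = c j *\<^sub>C H t x"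
    and near: "\<And>t x. t \<in> I \<Longrightarrow> x \<in> B \<Longrightarrow> norm (H t x - G t x) \<le> real (card A) * \<epsilon>"
    and keep: "\<And>v d \<delta> t x. \<lbrakk>\<And>j. j \<in> A \<Longrightarrow> v $ j = 0;
        \<And>t x. t \<in> I \<Longrightarrow> x \<in> B \<Longrightarrow> norm (G (t + v) x - d *\<^sub>C G t x) \<le> \<delta>; t \<in> I; x \<in> B\<rbrakk>
        \<Longrightarrow> norm (H (t + v) x - d *\<^sub>C H t x) \<le> \<delta>"
    by metis
  let ?K = "fold_coord i (b i) (\<omega> i) (c i) B H"
  have shift: "norm (?K (t + v) x - d *\<^sub>C ?K t x) \<le> \<delta>"
    if "v $ i = 0" "t \<in> I" "x \<in> B"
      and "\<And>t x. t \<in> I \<Longrightarrow> x \<in> B \<Longrightarrow> norm (H (t + v) x - d *\<^sub>C H t x) \<le> \<delta>" for v d \<delta> t x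
    using that c by (intro fold_coord_shift[where I = I] base) auto
  show ?case
  proof (intro exI[of _ ?K] conjI ballI allI impI)
    show "continuous_map (top_of_set I) (mtopology_of (l_inf B)) ?K"
      by (intro continuous_map_fold_coord B H \<omega> base)
  next
    fix j t x assume j: "j \<in> insert i A" and t: "t \<in> I" and x: "x \<in> B"
    show "?K (t + \<omega> j *\<^sub>R axis j 1) x = c j *\<^sub>C ?K t x"
    proof (cases "j = i")
      case True
      then show ?thesis by (simp add: fold_coord_periodic \<omega> c x)
    next
      case False
      then have "(\<omega> j *\<^sub>R axis j 1 :: real ^ 'n) $ i = 0"
        by (simp add: axis_def)
      \<comment> \<open>An exact period is one with defect 0, so the periods gained earlier survive
        folding in \<open>i\<close>.\<close>
      from shift[OF this t x, of "c j" 0] j False have "norm (?K (t + \<omega> j *\<^sub>R axis j 1) x - c j *\<^sub>C ?K t x) \<le> 0"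
        by (simp add: per)
      then show ?thesis by simp
    qed
  next
    fix t x assume t: "t \<in> I" and x: "x \<in> B"
    have "norm (?K t x - H t x) \<le> \<epsilon>"
    proof (rule fold_coord_approx[where I = I, OF c x t base[OF t]])
      fix m :: nat and t assume "t \<in> I"
      \<comment> \<open>Because \<open>i\<close> is not in \<open>A\<close>, shifts along axis
        \<open>i\<close> vanish on \<open>A\<close> and \<open>keep\<close> passes the defect bound
        from \<open>G\<close> to \<open>H\<close>.\<close>
      with insert.hyps approx x
      show "norm (H (t + (real m * \<omega> i) *\<^sub>R axis i 1) x - (c i ^ m) *\<^sub>C H t x) \<le> \<epsilon>"
        by (intro keep) (auto simp: axis_def)
    qed
    with near[OF t x] norm_triangle_ineq[of "?K t x - H t x" "H t x - G t x"]
    show "norm (?K t x - G t x) \<le> real (card (insert i A)) * \<epsilon>"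
      using insert.hyps by (simp add: algebra_simps)
  next
    fix v d \<delta> t x
    assume "\<forall>j\<in>insert i A. v $ j = 0"
      and "\<forall>t\<in>I. \<forall>x\<in>B. norm (G (t + v) x - d *\<^sub>C G t x) \<le> \<delta>" and "t \<in> I" "x \<in> B"
    then show "norm (?K (t + v) x - d *\<^sub>C ?K t x) \<le> \<delta>"
      by (intro shift keep) auto
  qed
qed

section \<open>Base points on lines and half-lines\<close>

text \<open>On a half-line the base point is the endpoint: stability forces \<omega> to point
  inwards, so going back at most \<open>(t $ j - b) / \<omega>\<close> periods cannot pass the
  endpoint. On the full line any \<open>b\<close> works.\<close>

lemma exists_base_point:
  fixes J :: "'n::finite \<Rightarrow> real set"
  assumes J: "J j = UNIV \<or> (\<exists>a. J j = {..a}) \<or> (\<exists>a. J j = {a..})"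
    and I: "I = {t. \<forall>j. t $ j \<in> J j}"
    and \<omega>: "\<omega> \<noteq> 0" and stable: "\<And>t. t \<in> I \<Longrightarrow> t + \<omega> *\<^sub>R axis j 1 \<in> I"
  shows "\<exists>b. \<forall>t\<in>I. \<forall>k. real_of_int k \<le> (t $ j - b) / \<omega> \<longrightarrow> t - (k * \<omega>) *\<^sub>R axis j 1 \<in> I"
proof -
  have mem: "t + r *\<^sub>R axis j 1 \<in> I \<longleftrightarrow> t $ j + r \<in> J j" if "t \<in> I" for t r
    using that by (auto simp: I axis_def)
  have mem': "t - r *\<^sub>R axis j 1 \<in> I \<longleftrightarrow> t $ j - r \<in> J j" if "t \<in> I" for t r
    using mem[OF that, of "- r"] by simp
  \<comment> \<open>Sliding \<open>t\<close> along axis \<open>j\<close> until its coordinate is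
    \<open>a\<close> stays in the product \<open>I\<close>, so stability of \<open>I\<close> yields
    stability of \<open>J j\<close>.\<close>
  have edge: "a + \<omega> \<in> J j" if "a \<in> J j" "t \<in> I" for a t
  proof -
    have "t + (a - t $ j) *\<^sub>R axis j 1 \<in> I"
      using that by (simp add: mem)
    from stable[OF this] mem[OF this, of \<omega>] show ?thesis
      by simp
  qed
  consider "J j = UNIV" | a where "J j = {..a}" | a where "J j = {a..}"
    using J by blast
  then show ?thesis
  proof cases
    case 1
    then show ?thesis by (simp add: mem')
  next
    case (2 a)
    have "t $ j - k * \<omega> \<le> a" if t: "t \<in> I" and k: "real_of_int k \<le> (t $ j - a) / \<omega>" for t k
    proof -
      have "\<omega> < 0" using edge[OF _ t, of a] 2 \<omega> by auto
      with k show ?thesis by (simp add: field_simps)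
    qed
    then show ?thesis using 2 by (intro exI[of _ a]) (simp add: mem')
  next
    case (3 a)
    have "a \<le> t $ j - k * \<omega>" if t: "t \<in> I" and k: "real_of_int k \<le> (t $ j - a) / \<omega>" for t k
    proof -
      have "\<omega> > 0" using edge[OF _ t, of a] 3 \<omega> by auto
      with k show ?thesis by (simp add: field_simps)
    qed
    then show ?thesis using 3 by (intro exI[of _ a]) (simp add: mem')
  qed
qed

section \<open>Uniform limits and iterated periods\<close>

lemma continuous_map_uniform_limit_l_inf:
  assumes "\<And>k. continuous_map (top_of_set I) (mtopology_of (l_inf B)) (Fk k)"
    and "converges_uniformly I (l_inf B) Fk g"
  shows "continuous_map (top_of_set I) (mtopology_of (l_inf B)) g"
proof -
  interpret L: Metric_space "mspace (l_inf B)" "mdist (l_inf B)" by simp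
  show ?thesis
    unfolding mtopology_of_def
    by (rule L.continuous_map_uniform_limit_alt[where F = sequentially and f = Fk])
      (use assms in \<open>auto simp: converges_uniformly_def mtopology_of_def\<close>)
qed

text \<open>Membership in \<open>I\<close> is carried through the induction because
  \<open>per\<close> may be applied only at points of \<open>I\<close>.\<close>

lemma periodic_iterate:
  assumes stable: "\<And>t. t \<in> I \<Longrightarrow> t + \<omega> *\<^sub>R axis j 1 \<in> I"
    and per: "\<And>t. t \<in> I \<Longrightarrow> G (t + \<omega> *\<^sub>R axis j 1) = l_inf_scale B a (G t)"
    and t: "t \<in> I" and x: "x \<in> B"
  shows "t + (real m * \<omega>) *\<^sub>R axis j 1 \<in> I \<and> G (t + (real m * \<omega>) *\<^sub>R axis j 1) x = (a ^ m) *\<^sub>C G t x"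
proof (induction m)
  case 0
  then show ?case using t by simp
next
  case (Suc m)
  define u where "u = t + (real m * \<omega>) *\<^sub>R axis j 1"
  have u: "t + (real (Suc m) * \<omega>) *\<^sub>R axis j 1 = u + \<omega> *\<^sub>R axis j 1"
    by (simp add: u_def algebra_simps)
  show ?case
    using Suc x unfolding u u_def[symmetric]
    by (auto simp: stable per l_inf_scale_def scaleC_scaleC)
qed

section \<open>Semi-periodicity versus approximation by periodic functions\<close>

lemma semi_periodic_imp_approximable:
  fixes J :: "'n::finite \<Rightarrow> real set"
    and F :: "real ^ 'n \<Rightarrow> 'a::complex_banach \<Rightarrow> 'b::complex_banach"
  assumes J: "\<And>j. J j = UNIV \<or> (\<exists>a. J j = {..a}) \<or> (\<exists>a. J j = {a..})"
    and I: "I = {t. \<forall>j. t $ j \<in> J j}"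
    and c: "\<And>j. cmod (c j) = 1"
    and B: "B \<in> \<B>" "B \<noteq> {}"
    and semi: "semi_periodic I c \<B> F"
    and cont: "continuous_map (top_of_set I) (mtopology_of (l_inf B)) (F_on F B)"
    and \<epsilon>: "\<epsilon> > 0"
  shows "\<exists>H. cj_periodic I c (l_inf B) (l_inf_scale B) H \<and>
    (\<forall>t\<in>I. mdist (l_inf B) (H t) (F_on F B t) \<le> \<epsilon>)"
proof -
  \<comment> \<open>Each of the \<open>CARD('n)\<close> foldings costs \<eta>, which adds up to
    \<epsilon>.\<close>
  define \<eta> where "\<eta> = \<epsilon> / real CARD('n)"
  have "\<eta> > 0" using \<epsilon> by (simp add: \<eta>_def)
  then obtain \<omega> where \<omega>: "\<And>j. \<omega> j \<noteq> 0"
    and stable: "\<And>j t. t \<in> I \<Longrightarrow> t + \<omega> j *\<^sub>R axis j 1 \<in> I"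
    and approx: "\<And>(m::nat) j t x. t \<in> I \<Longrightarrow> x \<in> B \<Longrightarrow>
        norm (F (t + (real m * \<omega> j) *\<^sub>R axis j 1) x - (c j ^ m) *\<^sub>C F t x) \<le> \<eta>"
    using semi B(1) unfolding semi_periodic_def by (metis (no_types, lifting))
  have "\<forall>j. \<exists>b. \<forall>t\<in>I. \<forall>k. real_of_int k \<le> (t $ j - b) / \<omega> j \<longrightarrow> t - (k * \<omega> j) *\<^sub>R axis j 1 \<in> I"
    using exists_base_point[OF J I \<omega> stable] by blast
  then obtain b where base: "\<And>j t k. t \<in> I \<Longrightarrow> real_of_int k \<le> (t $ j - b j) / \<omega> j
      \<Longrightarrow> t - (k * \<omega> j) *\<^sub>R axis j 1 \<in> I"
    by metis
  have approx': "norm (F_on F B (t + (real m * \<omega> j) *\<^sub>R axis j 1) x - (c j ^ m) *\<^sub>C F_on F B t x) \<le> \<eta>"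
    if "t \<in> I" "x \<in> B" for m :: nat and j t x
    using approx[OF that] that by (simp add: F_on_def)
  obtain H where H: "continuous_map (top_of_set I) (mtopology_of (l_inf B)) H"
    and per: "\<And>j t x. t \<in> I \<Longrightarrow> x \<in> B \<Longrightarrow> H (t + \<omega> j *\<^sub>R axis j 1) x = c j *\<^sub>C H t x"
    and near: "\<And>t x. t \<in> I \<Longrightarrow> x \<in> B \<Longrightarrow> norm (H t x - F_on F B t x) \<le> real CARD('n) * \<eta>"
    using exists_periodic_approx[where A = UNIV and b = b, OF B(2) cont c \<omega> base approx' finite] by auto
  have sp: "H t \<in> mspace (l_inf B)" "F_on F B t \<in> mspace (l_inf B)" if "t \<in> I" for t
    using that continuous_map_l_inf[OF B(2)] H cont by (metis topspace_euclidean_subtopology)+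
  \<comment> \<open>Equality on \<open>B\<close> becomes equality of functions, both sides being
    \<open>undefined\<close> outside \<open>B\<close>.\<close>
  have "H (t + \<omega> j *\<^sub>R axis j 1) = l_inf_scale B (c j) (H t)" if "t \<in> I" for j t
    using sp(1)[OF stable[OF that]] per[OF that]
    by (auto simp: mspace_l_inf l_inf_scale_def extensional_def fun_eq_iff)
  moreover have "mdist (l_inf B) (H t) (F_on F B t) \<le> \<epsilon>" if "t \<in> I" for t
    using near[OF that] sp[OF that] B(2) by (intro mdist_l_inf_le) (auto simp: \<eta>_def)
  ultimately show ?thesis
    using H \<omega> stable unfolding cj_periodic_def by blast
qed

text \<open>Approximation in \<open>l_inf B\<close> forces \<open>F_on F B\<close> to be continuous
  into \<open>l_inf B\<close>. Joint continuity of \<open>F\<close> does not: for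
  \<open>F t x = x\<close>, all \<open>c j = 1\<close> and unbounded \<open>B\<close>,
  semi-periodicity holds while \<open>F_on F B\<close> leaves \<open>l_inf B\<close>. Hence the
  continuity condition beside semi-periodicity.\<close>

theorem theorem2p10:
  fixes J :: "'n::finite \<Rightarrow> real set"
    and I :: "(real ^ 'n) set"
    and c :: "'n \<Rightarrow> complex"
    and \<B> :: "'a::complex_banach set set"
    and F :: "real ^ 'n \<Rightarrow> 'a \<Rightarrow> 'b::complex_banach"
  assumes J: "\<And>j. J j = UNIV \<or> (\<exists>a. J j = {..a}) \<or> (\<exists>a. J j = {a..})"
    and I: "I = {t. \<forall>j. t $ j \<in> J j}"
    and c: "\<And>j. cmod (c j) = 1"
    and B_nonempty: "\<And>B. B \<in> \<B> \<Longrightarrow> B \<noteq> {}"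
    and B_cover: "\<And>x. \<exists>B\<in>\<B>. x \<in> B"
    and F: "continuous_on (I \<times> UNIV) (\<lambda>(t, x). F t x)"
  shows "semi_periodic I c \<B> F \<and>
         (\<forall>B\<in>\<B>. continuous_map (top_of_set I) (mtopology_of (l_inf B)) (F_on F B))
     \<longleftrightarrow>
         (\<forall>B\<in>\<B>. \<exists>Fk :: nat \<Rightarrow> real ^ 'n \<Rightarrow> 'a \<Rightarrow> 'b.
            (\<forall>k. cj_periodic I c (l_inf B) (l_inf_scale B) (Fk k)) \<and>
            converges_uniformly I (l_inf B) Fk (F_on F B))"
    (is "?semi \<and> ?cont \<longleftrightarrow> ?lim")
proof
  assume L: "?semi \<and> ?cont"
  show ?lim
  proof
    fix B assume B: "B \<in> \<B>"
    then have cont: "continuous_map (top_of_set I) (mtopology_of (l_inf B)) (F_on F B)"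
      using L by blast
    \<comment> \<open>\<open>Suc k\<close> keeps the tolerance positive at
      \<open>k = 0\<close>.\<close>
    have "\<exists>H. cj_periodic I c (l_inf B) (l_inf_scale B) H \<and>
        (\<forall>t\<in>I. mdist (l_inf B) (H t) (F_on F B t) \<le> inverse (real (Suc k)))" for k
      using L by (intro semi_periodic_imp_approximable[OF J I c B B_nonempty[OF B] _ cont]) auto
    then obtain Fk where Fk: "\<And>k. cj_periodic I c (l_inf B) (l_inf_scale B) (Fk k)"
      and near: "\<And>k t. t \<in> I \<Longrightarrow> mdist (l_inf B) (Fk k t) (F_on F B t) \<le> inverse (real (Suc k))"
      by metis
    have "\<forall>\<^sub>F k in sequentially. \<forall>t\<in>I. mdist (l_inf B) (Fk k t) (F_on F B t) < \<epsilon>" if "\<epsilon> > 0" for \<epsilon>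
      using order_tendstoD(2)[OF LIMSEQ_inverse_real_of_nat that]
      by eventually_elim (use near in \<open>auto intro: le_less_trans\<close>)
    moreover have "F_on F B t \<in> mspace (l_inf B)" if "t \<in> I" for t
      using that cont continuous_map_l_inf[OF B_nonempty[OF B]]
      by (metis topspace_euclidean_subtopology)
    ultimately show "\<exists>Fk :: nat \<Rightarrow> real ^ 'n \<Rightarrow> 'a \<Rightarrow> 'b.
        (\<forall>k. cj_periodic I c (l_inf B) (l_inf_scale B) (Fk k)) \<and>
        converges_uniformly I (l_inf B) Fk (F_on F B)"
      using Fk unfolding converges_uniformly_def by blast
  qed
next
  assume R: ?lim
  have cont: ?cont
  proof
    fix B assume "B \<in> \<B>"
    then obtain Fk :: "nat \<Rightarrow> real ^ 'n \<Rightarrow> 'a \<Rightarrow> 'b" where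
      Fk: "\<And>k. cj_periodic I c (l_inf B) (l_inf_scale B) (Fk k)"
      and lim: "converges_uniformly I (l_inf B) Fk (F_on F B)"
      using R by blast
    have "continuous_map (top_of_set I) (mtopology_of (l_inf B)) (Fk k)" for k
      using Fk[of k] by (simp add: cj_periodic_def)
    then show "continuous_map (top_of_set I) (mtopology_of (l_inf B)) (F_on F B)"
      using lim by (rule continuous_map_uniform_limit_l_inf)
  qed
  have "\<exists>\<omega> :: 'n \<Rightarrow> real.
      (\<forall>j. \<omega> j \<noteq> 0 \<and> (\<forall>t\<in>I. t + \<omega> j *\<^sub>R axis j 1 \<in> I)) \<and>
      (\<forall>m::nat. \<forall>j. \<forall>t\<in>I. \<forall>x\<in>B.
         norm (F (t + (real m * \<omega> j) *\<^sub>R axis j 1) x - (c j ^ m) *\<^sub>C F t x) \<le> \<epsilon>)"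
    if \<epsilon>: "\<epsilon> > 0" and B: "B \<in> \<B>" for \<epsilon> B
  proof -
    obtain Fk :: "nat \<Rightarrow> real ^ 'n \<Rightarrow> 'a \<Rightarrow> 'b" where
      Fk: "\<And>k. cj_periodic I c (l_inf B) (l_inf_scale B) (Fk k)"
      and lim: "converges_uniformly I (l_inf B) Fk (F_on F B)"
      using R B by blast
    \<comment> \<open>The approximation error enters twice, at \<open>t\<close> and at its
      translate, hence the half.\<close>
    have "\<forall>\<^sub>F k in sequentially. \<forall>t\<in>I. mdist (l_inf B) (Fk k t) (F_on F B t) < \<epsilon> / 2"
      using lim half_gt_zero[OF \<epsilon>] unfolding converges_uniformly_def by blast
    then obtain k where k: "\<And>t. t \<in> I \<Longrightarrow> mdist (l_inf B) (Fk k t) (F_on F B t) < \<epsilon> / 2"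
      by (auto simp: eventually_sequentially)
    have sp: "Fk k t \<in> mspace (l_inf B)" "F_on F B t \<in> mspace (l_inf B)" if "t \<in> I" for t
      using that Fk[of k] lim continuous_map_l_inf[OF B_nonempty[OF B]]
      unfolding cj_periodic_def converges_uniformly_def
      by (metis topspace_euclidean_subtopology)+
    have near: "norm (Fk k t x - F t x) \<le> \<epsilon> / 2" if "t \<in> I" "x \<in> B" for t x
      using norm_diff_le_mdist_l_inf[OF sp(1,2)[OF that(1)] that(2)] k[OF that(1)] that
      by (simp add: F_on_def)
    obtain \<omega> where \<omega>: "\<And>j. \<omega> j \<noteq> 0"
      and stable: "\<And>j t. t \<in> I \<Longrightarrow> t + \<omega> j *\<^sub>R axis j 1 \<in> I"
      and per: "\<And>j t. t \<in> I \<Longrightarrow> Fk k (t + \<omega> j *\<^sub>R axis j 1) = l_inf_scale B (c j) (Fk k t)"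
      using Fk[of k] unfolding cj_periodic_def by metis
    have "norm (F (t + (real m * \<omega> j) *\<^sub>R axis j 1) x - (c j ^ m) *\<^sub>C F t x) \<le> \<epsilon>"
      if t: "t \<in> I" and x: "x \<in> B" for m j t x
    proof -
      let ?t = "t + (real m * \<omega> j) *\<^sub>R axis j 1"
      have t': "?t \<in> I" and Fk': "Fk k ?t x = (c j ^ m) *\<^sub>C Fk k t x"
        using periodic_iterate[where G = "Fk k", OF stable per t x] by auto
      \<comment> \<open>The periodic terms cancel, and \<open>c j ^ m\<close> is unimodular, so the
        bound is uniform in \<open>m\<close>.\<close>
      have "F ?t x - (c j ^ m) *\<^sub>C F t x =
          (c j ^ m) *\<^sub>C (Fk k t x - F t x) - (Fk k ?t x - F ?t x)"
        by (simp add: Fk' scaleC_diff_right)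
      also have "norm \<dots> \<le> norm (Fk k t x - F t x) + norm (Fk k ?t x - F ?t x)"
        by (rule order_trans[OF norm_triangle_ineq4]) (simp add: norm_scaleC norm_power c)
      also have "\<dots> \<le> \<epsilon>"
        using near[OF t x] near[OF t' x] by simp
      finally show ?thesis .
    qed
    with \<omega> stable show ?thesis by blast
  qed
  with F cont show "?semi \<and> ?cont"
    unfolding semi_periodic_def by blast
qed

end
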